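(* Let $G$ be a finite simple connected graph with $m>0$ edges, maximum degree $\Delta$ and minimum degree $\delta$. Then $$\frac{m}{\sqrt{2}}+\frac{Alb(G)^2}{16\sqrt{2}\,m \Delta^2}\le DSO(G) \le \frac{m}{\sqrt{2}} + \frac{Alb(G)}{4\sqrt{2}\,\delta}.$$ For each of the two bounds, equality holds if and only if $G$ is regular.
   Context: For a finite simple graph $G=(V(G),E(G))$, $d_u$ denotes the degree of the vertex $u$. The Diminished Sombor index is $DSO(G)=\sum_{uv\in E(G)}\frac{\sqrt{d_u^2+d_v^2}}{d_u+d_v}$. The Albertson index is $Alb(G)=\sum_{uv\in E(G)}|d_u-d_v|$. *)

theory Defs
  imports Complex_Main
begin

text \<open>A graph is given by its vertex set \<open>V\<close> and its edge set \<open>E\<close>, an edge being the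
  two-element set of its endpoints.\<close>

definition simple_graph :: "'a set \<Rightarrow> 'a set set \<Rightarrow> bool" where
  "simple_graph V E \<longleftrightarrow> finite V \<and> (\<forall>e\<in>E. e \<subseteq> V \<and> card e = 2)"

definition connected_graph :: "'a set \<Rightarrow> 'a set set \<Rightarrow> bool" where
  "connected_graph V E \<longleftrightarrow>
     V \<noteq> {} \<and> (\<forall>u\<in>V. \<forall>v\<in>V. (u, v) \<in> {(x, y). {x, y} \<in> E}\<^sup>*)"

definition degree :: "'a set set \<Rightarrow> 'a \<Rightarrow> nat" where
  "degree E v = card {e \<in> E. v \<in> e}"

definition max_degree :: "'a set \<Rightarrow> 'a set set \<Rightarrow> nat" where
  "max_degree V E = Max (degree E ` V)"

definition min_degree :: "'a set \<Rightarrow> 'a set set \<Rightarrow> nat" where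
  "min_degree V E = Min (degree E ` V)"

definition regular_graph :: "'a set \<Rightarrow> 'a set set \<Rightarrow> bool" where
  "regular_graph V E \<longleftrightarrow> (\<exists>k. \<forall>v\<in>V. degree E v = k)"

text \<open>The sum of \<open>f u v\<close> over all edges \<open>uv\<close>, each unordered edge being counted once. This is
  meaningful for symmetric \<open>f\<close> only, where the description below denotes \<open>f u v\<close>
  (lemma \<open>edge_value_eq\<close>).\<close>

definition edge_value :: "('a \<Rightarrow> 'a \<Rightarrow> real) \<Rightarrow> 'a set \<Rightarrow> real" where
  "edge_value f e = (THE w. \<exists>u v. e = {u, v} \<and> w = f u v)"

definition edge_sum :: "'a set set \<Rightarrow> ('a \<Rightarrow> 'a \<Rightarrow> real) \<Rightarrow> real" where
  "edge_sum E f = (\<Sum>e\<in>E. edge_value f e)"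

lemma edge_value_eq:
  assumes "\<And>x y. f x y = f y x"
  shows "edge_value f {u, v} = f u v"
  unfolding edge_value_def
  by (rule the_equality) (use assms in \<open>auto simp: doubleton_eq_iff\<close>)

definition DSO :: "'a set set \<Rightarrow> real" where
  "DSO E = edge_sum E (\<lambda>u v.
     sqrt ((real (degree E u))\<^sup>2 + (real (degree E v))\<^sup>2) / (real (degree E u) + real (degree E v)))"

definition Alb :: "'a set set \<Rightarrow> real" where
  "Alb E = edge_sum E (\<lambda>u v. \<bar>real (degree E u) - real (degree E v)\<bar>)"

end

theory Submission imports Defs "HOL-Analysis.Convex" begin

text \<open>
  Put \<open>r = \<bar>a - b\<bar> / (a + b)\<close> for an edge whose endpoints have degrees \<open>a\<close> and \<open>b\<close>. Since
  \<open>2 (a\<^sup>2 + b\<^sup>2) = (a + b)\<^sup>2 + (a - b)\<^sup>2\<close>, the edge contributes \<open>sqrt (1 + r\<^sup>2) / sqrt 2\<close> to the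
  diminished Sombor index, with \<open>0 \<le> r \<le> 1\<close>. On that range
  \<open>1 + r\<^sup>2 / 4 \<le> sqrt (1 + r\<^sup>2) \<le> 1 + r / 2\<close>, both strict for \<open>r \<noteq> 0\<close>
  (lemma \<open>sqrt_one_plus_square_bounds\<close>), and \<open>2 \<delta> \<le> a + b \<le> 2 \<Delta>\<close> turns \<open>r\<close> into a multiple of
  \<open>\<bar>a - b\<bar>\<close> (lemmas \<open>sombor_term_lower\<close> and \<open>sombor_term_upper\<close>).

  Summing over the edges gives the upper bound directly. The lower bound comes out with
  \<open>\<Sum>(a - b)\<^sup>2\<close>, which the Cauchy--Schwarz inequality bounds below by the square of the Albertson
  index over \<open>m\<close>. Equality in either bound forces equality on every edge, so adjacent vertices
  have equal degrees, and connectedness spreads this to the whole graph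
  (lemma \<open>regular_graph_iff_edges_balanced\<close>).
\<close>

section \<open>The contribution of one edge\<close>

lemma sombor_term_eq:
  fixes a b :: real
  assumes "a > 0" "b > 0"
  shows "sqrt (a\<^sup>2 + b\<^sup>2) / (a + b) = sqrt (1 + (\<bar>a - b\<bar> / (a + b))\<^sup>2) / sqrt 2"
proof -
  have "(a + b)\<^sup>2 * (\<bar>a - b\<bar> / (a + b))\<^sup>2 = (a - b)\<^sup>2"
    using assms by (simp add: power_divide)
  then have "a\<^sup>2 + b\<^sup>2 = (a + b)\<^sup>2 * ((1 + (\<bar>a - b\<bar> / (a + b))\<^sup>2) / 2)"
    by (simp add: distrib_left power2_sum power2_diff)
  then have "sqrt (a\<^sup>2 + b\<^sup>2) = (a + b) * sqrt ((1 + (\<bar>a - b\<bar> / (a + b))\<^sup>2) / 2)"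
    using assms by (simp only: real_sqrt_mult real_sqrt_abs)
  then show ?thesis
    using assms by (simp add: real_sqrt_divide)
qed

text \<open>After squaring, the claims become \<open>r\<^sup>4 / 16 < r\<^sup>2 / 2\<close> and \<open>r\<^sup>2 < r + r\<^sup>2 / 4\<close>. Both have
  slack on the whole interval, which is why only regular graphs attain the final bounds.\<close>

lemma sqrt_one_plus_square_bounds:
  fixes r :: real
  assumes "0 < r" "r \<le> 1"
  shows "1 + r\<^sup>2 / 4 < sqrt (1 + r\<^sup>2)" and "sqrt (1 + r\<^sup>2) < 1 + r / 2"
proof -
  have "0 < r\<^sup>2" "r\<^sup>2 \<le> 1" "r\<^sup>2 \<le> r"
    using assms by (simp, simp add: power_le_one, simp add: power2_eq_square mult_left_le)
  then have "r\<^sup>2 * r\<^sup>2 \<le> r\<^sup>2"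
    by (intro mult_left_le) auto
  moreover have "(1 + r\<^sup>2 / 4)\<^sup>2 = 1 + r\<^sup>2 / 2 + r\<^sup>2 * r\<^sup>2 / 16"
    by (simp add: power2_eq_square algebra_simps)
  ultimately have "(1 + r\<^sup>2 / 4)\<^sup>2 < 1 + r\<^sup>2"
    using \<open>0 < r\<^sup>2\<close> by linarith
  then show "1 + r\<^sup>2 / 4 < sqrt (1 + r\<^sup>2)"
    by (rule real_less_rsqrt)
  have "1 + r\<^sup>2 < (1 + r / 2)\<^sup>2"
    using \<open>r\<^sup>2 \<le> r\<close> \<open>0 < r\<close> by (simp add: power2_sum power_divide)
  then show "sqrt (1 + r\<^sup>2) < 1 + r / 2"
    using assms by (intro real_less_lsqrt) auto
qed

lemma sombor_term_lower:
  fixes a b D :: real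
  assumes "a > 0" "b > 0" "a \<le> D" "b \<le> D" "a \<noteq> b"
  shows "1 / sqrt 2 + 1 / (16 * sqrt 2 * D\<^sup>2) * \<bar>a - b\<bar>\<^sup>2 < sqrt (a\<^sup>2 + b\<^sup>2) / (a + b)"
proof -
  let ?r = "\<bar>a - b\<bar> / (a + b)"
  have r: "0 < ?r" "?r \<le> 1"
    using assms by (auto simp: divide_le_eq)
  have "\<bar>a - b\<bar> / (2 * D) \<le> ?r"
    using assms by (intro divide_left_mono) auto
  then have "(\<bar>a - b\<bar> / (2 * D))\<^sup>2 \<le> ?r\<^sup>2"
    using assms by (intro power_mono) auto
  then have "1 + (\<bar>a - b\<bar> / (2 * D))\<^sup>2 / 4 < sqrt (1 + ?r\<^sup>2)"
    using sqrt_one_plus_square_bounds(1)[OF r] by linarith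
  then have "(1 + (\<bar>a - b\<bar> / (2 * D))\<^sup>2 / 4) / sqrt 2 < sqrt (1 + ?r\<^sup>2) / sqrt 2"
    by (intro divide_strict_right_mono) auto
  then show ?thesis
    using assms by (simp add: sombor_term_eq power_divide power_mult_distrib add_divide_distrib
      mult_ac del: power2_abs)
qed

lemma sombor_term_upper:
  fixes a b d :: real
  assumes "d > 0" "d \<le> a" "d \<le> b" "a \<noteq> b"
  shows "sqrt (a\<^sup>2 + b\<^sup>2) / (a + b) < 1 / sqrt 2 + 1 / (4 * sqrt 2 * d) * \<bar>a - b\<bar>"
proof -
  let ?r = "\<bar>a - b\<bar> / (a + b)"
  have r: "0 < ?r" "?r \<le> 1"
    using assms by (auto simp: divide_le_eq)
  have "?r \<le> \<bar>a - b\<bar> / (2 * d)"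
    using assms by (intro divide_left_mono) auto
  then have "1 + ?r / 2 \<le> 1 + \<bar>a - b\<bar> / (2 * d) / 2"
    by (intro add_left_mono divide_right_mono) auto
  with sqrt_one_plus_square_bounds(2)[OF r]
  have "sqrt (1 + ?r\<^sup>2) < 1 + \<bar>a - b\<bar> / (2 * d) / 2"
    by (rule less_le_trans)
  then have "sqrt (1 + ?r\<^sup>2) / sqrt 2 < (1 + \<bar>a - b\<bar> / (2 * d) / 2) / sqrt 2"
    by (intro divide_strict_right_mono) auto
  then show ?thesis
    using assms by (simp add: sombor_term_eq add_divide_distrib mult_ac)
qed

lemma sombor_term_same:
  fixes a :: real
  assumes "a > 0"
  shows "sqrt (a\<^sup>2 + a\<^sup>2) / (a + a) = 1 / sqrt 2"
  using sombor_term_eq[OF assms assms] by simp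

section \<open>Sums over edges\<close>

lemma simple_graph_finite_edges:
  assumes "simple_graph V E"
  shows "finite E"
  using assms unfolding simple_graph_def
  by (intro finite_subset[of E "Pow V"]) auto

lemma simple_graph_edgeE:
  assumes "simple_graph V E" "e \<in> E"
  obtains u v where "e = {u, v}" "u \<noteq> v" "u \<in> V" "v \<in> V"
proof -
  have "e \<subseteq> V" "card e = 2"
    using assms unfolding simple_graph_def by auto
  then show thesis
    using that unfolding card_2_iff by auto
qed

text \<open>The value of an edge is a definite description that is determined only for symmetric
  functions, so even linearity of the edge sum depends on symmetry.\<close>

lemma edge_sum_affine:
  assumes "simple_graph V E" and "\<And>x y. f x y = f y x"
  shows "edge_sum E (\<lambda>u v. c + k * f u v) = real (card E) * c + k * edge_sum E f"
proof -
  have "edge_value (\<lambda>u v. c + k * f u v) e = c + k * edge_value f e" if "e \<in> E" for e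
  proof -
    from assms(1) that obtain u v where "e = {u, v}" by (rule simple_graph_edgeE)
    moreover have "\<And>x y. c + k * f x y = c + k * f y x"
      by (simp add: assms(2))
    ultimately show ?thesis
      by (simp add: edge_value_eq[of f, OF assms(2)]
          edge_value_eq[of "\<lambda>u v. c + k * f u v"])
  qed
  then show ?thesis
    by (simp add: edge_sum_def sum.distrib sum_distrib_left)
qed

lemma edge_sum_square_le:
  assumes "simple_graph V E" and "\<And>x y. f x y = f y x"
  shows "(edge_sum E f)\<^sup>2 \<le> edge_sum E (\<lambda>u v. (f u v)\<^sup>2) * real (card E)"
proof -
  have "edge_value (\<lambda>u v. (f u v)\<^sup>2) e = (edge_value f e)\<^sup>2" if "e \<in> E" for e
  proof -
    from assms(1) that obtain u v where "e = {u, v}" by (rule simple_graph_edgeE)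
    moreover have "\<And>x y. (f x y)\<^sup>2 = (f y x)\<^sup>2"
      by (simp add: assms(2))
    ultimately show ?thesis
      by (simp add: edge_value_eq[of f, OF assms(2)] edge_value_eq[of "\<lambda>u v. (f u v)\<^sup>2"])
  qed
  then show ?thesis
    using sum_squared_le_sum_of_squares[of "edge_value f" E]
    by (simp add: edge_sum_def)
qed

text \<open>This is how equality in a bound on the whole sum is traced back to the individual edges:
  a termwise inequality that is strict on the edges violating \<open>P\<close> can sum to an equality only if
  no edge violates \<open>P\<close>.\<close>

lemma edge_sum_mono_eqD:
  assumes G: "simple_graph V E"
    and sym: "\<And>x y. f x y = f y x" "\<And>x y. g x y = g y x"
    and le: "\<And>u v. {u, v} \<in> E \<Longrightarrow> f u v \<le> g u v"
    and less: "\<And>u v. {u, v} \<in> E \<Longrightarrow> \<not> P u v \<Longrightarrow> f u v < g u v"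
  shows "edge_sum E f \<le> edge_sum E g"
    and "edge_sum E g \<le> edge_sum E f \<Longrightarrow> {u, v} \<in> E \<Longrightarrow> P u v"
proof -
  have val: "edge_value f {u, v} = f u v" "edge_value g {u, v} = g u v" for u v
    by (rule edge_value_eq, rule sym)+
  have termwise: "edge_value f e \<le> edge_value g e" if "e \<in> E" for e
  proof -
    from G that obtain u v where "e = {u, v}" by (rule simple_graph_edgeE)
    then show ?thesis using le that by (simp add: val)
  qed
  then show "edge_sum E f \<le> edge_sum E g"
    unfolding edge_sum_def by (rule sum_mono)
  show "P u v" if "edge_sum E g \<le> edge_sum E f" "{u, v} \<in> E"
  proof (rule ccontr)
    assume "\<not> P u v"
    then have "edge_value f {u, v} < edge_value g {u, v}"
      using less that(2) by (simp add: val)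
    then have "edge_sum E f < edge_sum E g"
      unfolding edge_sum_def using simple_graph_finite_edges[OF G] termwise that(2)
      by (intro sum_strict_mono_ex1) auto
    then show False using that(1) by simp
  qed
qed

section \<open>Degrees in connected graphs\<close>

text \<open>An edge supplies a second vertex, and the first step of a path towards it is an edge at
  the given vertex. Hence \<open>\<delta> > 0\<close>, so the quotients by degrees are genuine ones.\<close>

lemma connected_degree_pos:
  assumes G: "simple_graph V E" and conn: "connected_graph V E"
    and "E \<noteq> {}" "w \<in> V"
  shows "degree E w > 0"
proof -
  from \<open>E \<noteq> {}\<close> obtain e where "e \<in> E" by blast
  from G this obtain u v where "u \<noteq> v" "u \<in> V" "v \<in> V" by (rule simple_graph_edgeE)
  then obtain z where "z \<in> V" "z \<noteq> w" by metis
  then have "(w, z) \<in> {(x, y). {x, y} \<in> E}\<^sup>*"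
    using conn \<open>w \<in> V\<close> unfolding connected_graph_def by blast
  with \<open>z \<noteq> w\<close> obtain y where "{w, y} \<in> E"
    by (auto elim: converse_rtranclE)
  then have "{e \<in> E. w \<in> e} \<noteq> {}" by blast
  then show ?thesis
    unfolding degree_def using simple_graph_finite_edges[OF G] by (simp add: card_gt_0_iff)
qed

lemma regular_graph_iff_edges_balanced:
  assumes G: "simple_graph V E" and conn: "connected_graph V E"
  shows "regular_graph V E \<longleftrightarrow> (\<forall>u v. {u, v} \<in> E \<longrightarrow> degree E u = degree E v)"
proof
  assume "regular_graph V E"
  then show "\<forall>u v. {u, v} \<in> E \<longrightarrow> degree E u = degree E v"
    using G unfolding regular_graph_def simple_graph_def by (metis insert_subset)
next
  assume bal: "\<forall>u v. {u, v} \<in> E \<longrightarrow> degree E u = degree E v"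
  have walk: "degree E u = degree E v" if "(u, v) \<in> {(x, y). {x, y} \<in> E}\<^sup>*" for u v
    using that by (induction rule: rtrancl_induct) (auto simp: bal)
  from conn obtain u where "u \<in> V"
    unfolding connected_graph_def by blast
  then have "\<forall>v\<in>V. degree E v = degree E u"
    using walk conn unfolding connected_graph_def by metis
  then show "regular_graph V E"
    unfolding regular_graph_def by blast
qed

section \<open>The bounds\<close>

theorem theorem9:
  fixes V :: "'a set" and E :: "'a set set" and m \<Delta> \<delta> :: nat
  assumes "simple_graph V E" and "connected_graph V E"
    and "m = card E" and "m > 0"
    and "\<Delta> = max_degree V E" and "\<delta> = min_degree V E"
  shows "real m / sqrt 2 + (Alb E)\<^sup>2 / (16 * sqrt 2 * real m * (real \<Delta>)\<^sup>2) \<le> DSO E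
    \<and> DSO E \<le> real m / sqrt 2 + Alb E / (4 * sqrt 2 * real \<delta>)
    \<and> (real m / sqrt 2 + (Alb E)\<^sup>2 / (16 * sqrt 2 * real m * (real \<Delta>)\<^sup>2) = DSO E
          \<longleftrightarrow> regular_graph V E)
    \<and> (DSO E = real m / sqrt 2 + Alb E / (4 * sqrt 2 * real \<delta>)
          \<longleftrightarrow> regular_graph V E)"
proof -
  note G = assms(1)
  let ?d = "\<lambda>v. real (degree E v)"
  let ?t = "\<lambda>u v. \<bar>?d u - ?d v\<bar>"
  let ?s = "\<lambda>u v. sqrt ((?d u)\<^sup>2 + (?d v)\<^sup>2) / (?d u + ?d v)"
  let ?bal = "\<lambda>u v. degree E u = degree E v"
  let ?L = "real m / sqrt 2 + (Alb E)\<^sup>2 / (16 * sqrt 2 * real m * (real \<Delta>)\<^sup>2)"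
  let ?U = "real m / sqrt 2 + Alb E / (4 * sqrt 2 * real \<delta>)"
  define k where "k = 1 / (16 * sqrt 2 * (real \<Delta>)\<^sup>2)"
  define h where "h = 1 / (4 * sqrt 2 * real \<delta>)"
  define lo where "lo = (\<lambda>u v. 1 / sqrt 2 + k * (?t u v)\<^sup>2)"
  define up where "up = (\<lambda>u v. 1 / sqrt 2 + h * ?t u v)"

  have sym: "?t x y = ?t y x" "?s x y = ?s y x" "lo x y = lo y x" "up x y = up y x" for x y
    by (simp_all add: lo_def up_def abs_minus_commute power2_commute add.commute)
  have sym2: "(?t x y)\<^sup>2 = (?t y x)\<^sup>2" for x y
    by (simp only: sym(1))

  have "E \<noteq> {}"
    using assms by auto
  have fin: "finite V" and "V \<noteq> {}"
    using G assms(2) unfolding simple_graph_def connected_graph_def by auto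
  have pos: "degree E w > 0" if "w \<in> V" for w
    using connected_degree_pos[OF G assms(2) \<open>E \<noteq> {}\<close> that] .
  have deg: "\<delta> \<le> degree E w" "degree E w \<le> \<Delta>" if "w \<in> V" for w
    using that fin assms(5,6) unfolding max_degree_def min_degree_def by auto
  have "\<delta> \<in> degree E ` V"
    using fin \<open>V \<noteq> {}\<close> assms(6) unfolding min_degree_def by auto
  then have "\<delta> > 0"
    using pos by auto

  have strict: "lo u v < ?s u v" "?s u v < up u v" if "{u, v} \<in> E" "\<not> ?bal u v" for u v
  proof -
    have "u \<in> V" "v \<in> V"
      using that G unfolding simple_graph_def by auto
    then show "lo u v < ?s u v" "?s u v < up u v"
      unfolding lo_def up_def k_def h_def using that(2) pos deg \<open>\<delta> > 0\<close>
      by (intro sombor_term_lower sombor_term_upper; simp)+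
  qed
  have same: "lo u v = ?s u v" "?s u v = up u v" if "{u, v} \<in> E" "?bal u v" for u v
  proof -
    have "?d u > 0"
      using that G pos unfolding simple_graph_def by auto
    then have "?s u v = 1 / sqrt 2"
      using sombor_term_same that(2) by simp
    then show "lo u v = ?s u v" "?s u v = up u v"
      using that(2) by (simp_all add: lo_def up_def)
  qed
  have weak: "lo u v \<le> ?s u v" "?s u v \<le> up u v" if "{u, v} \<in> E" for u v
    using strict[OF that] same[OF that] by fastforce+

  have sum_up: "edge_sum E up = ?U"
    unfolding up_def Alb_def using edge_sum_affine[OF G sym(1), of "1 / sqrt 2" h] assms(3)
    by (simp add: h_def)
  have sum_lo: "edge_sum E lo = real m / sqrt 2 + k * edge_sum E (\<lambda>u v. (?t u v)\<^sup>2)"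
    unfolding lo_def using edge_sum_affine[OF G sym2, of "1 / sqrt 2" k] assms(3)
    by simp
  have "(Alb E)\<^sup>2 / real m \<le> edge_sum E (\<lambda>u v. (?t u v)\<^sup>2)"
    using edge_sum_square_le[OF G sym(1)] assms(3,4) by (simp add: Alb_def divide_le_eq)
  then have "k * ((Alb E)\<^sup>2 / real m) \<le> k * edge_sum E (\<lambda>u v. (?t u v)\<^sup>2)"
    by (intro mult_left_mono) (simp_all add: k_def)
  then have L: "?L \<le> edge_sum E lo"
    unfolding sum_lo by (simp add: k_def mult_ac)

  have lower: "edge_sum E lo \<le> DSO E"
    and lower_eq: "\<And>u v. DSO E \<le> edge_sum E lo \<Longrightarrow> {u, v} \<in> E \<Longrightarrow> ?bal u v"
    unfolding DSO_def
    using edge_sum_mono_eqD[where f = lo and g = ?s and P = ?bal, OF G sym(3) sym(2)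
        weak(1) strict(1)] by blast+
  have upper: "DSO E \<le> ?U"
    and upper_eq: "\<And>u v. ?U \<le> DSO E \<Longrightarrow> {u, v} \<in> E \<Longrightarrow> ?bal u v"
    unfolding DSO_def sum_up[symmetric]
    using edge_sum_mono_eqD[where f = ?s and g = up and P = ?bal, OF G sym(2) sym(4)
        weak(2) strict(2)] by blast+

  note reg = regular_graph_iff_edges_balanced[OF G assms(2)]
  have eq_if: "?L = DSO E \<and> DSO E = ?U" if "regular_graph V E"
  proof -
    have bal: "?bal u v" if "{u, v} \<in> E" for u v
      using \<open>regular_graph V E\<close> that reg by blast
    have "edge_value ?t e = 0" if "e \<in> E" for e
    proof -
      from G that obtain u v where "e = {u, v}" by (rule simple_graph_edgeE)
      then show ?thesis
        using bal that edge_value_eq[of ?t, OF sym(1)] by simp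
    qed
    then have "Alb E = 0"
      by (simp add: Alb_def edge_sum_def)
    then show ?thesis
      using L lower upper by simp
  qed
  show ?thesis
  proof (intro conjI iffI)
    show "?L \<le> DSO E" using L lower by simp
    show "DSO E \<le> ?U" by (fact upper)
    show "regular_graph V E" if "?L = DSO E"
      using that L lower_eq reg by simp
    show "regular_graph V E" if "DSO E = ?U"
      using that upper_eq reg by simp
  qed (use eq_if in auto)
qed

end
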